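(* Let $(\Xi,\rho,\theta,\Sigma)$ and $(\Xi,\rho',\theta',\Sigma')$ be continuous groupoid actions, let $f:\Sigma\to\Sigma'$ be an epimorphism from the first to the second, and let $(\Xi(\theta'),f,\Theta,\Sigma)$ be the associated action of the action groupoid $\Xi(\theta')=\Xi\ltimes_{\theta'}\Sigma'$ on $\Sigma$. The two actions $(\Xi,\rho,\theta,\Sigma)$ and $(\Xi(\theta'),f,\Theta,\Sigma)$ have the same invariant sets. Consequently, each of the following properties holds for one of the two actions if and only if it holds for the other: transitivity, pointwise transitivity, topological transitivity, the property that $\Sigma$ is not the union of two proper invariant closed subsets, the property that each non-empty open invariant subset of $\Sigma$ is dense, and minimality. The fixed points of the two actions are the same.
   Context: All topological spaces are Hausdorff. A groupoid $\Xi$ is a small category in which all arrows are invertible; $X=\Xi^{(0)}$ is its unit space, $d,r:\Xi\to X$ are the source and range maps, and $\xi\eta$ is defined iff $d(\xi)=r(\eta)$. A topological groupoid is a groupoid with a (Hausdorff) topology making inversion and multiplication continuous (composable pairs carry the topology induced from $\Xi\times\Xi$); $X$ has the subspace topology. For $x\in X$, $\Xi_x=d^{-1}(\{x\})$. A continuous groupoid action $(\Xi,\rho,\theta,\Sigma)$ consists of a topological groupoid $\Xi$, a Hausdorff space $\Sigma$, a continuous surjection $\rho:\Sigma\to X$ (the anchor) and a continuous map $\theta:\{(\xi,\sigma)\in\Xi\times\Sigma: d(\xi)=\rho(\sigma)\}\to\Sigma$, $\theta_\xi(\sigma)=\xi\bullet\sigma$, with $\rho(\sigma)\bullet\sigma=\sigma$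 and: if $d(\xi)=r(\eta)$ and $d(\eta)=\rho(\sigma)$ then $d(\xi)=\rho(\eta\bullet\sigma)$ and $(\xi\eta)\bullet\sigma=\xi\bullet(\eta\bullet\sigma)$. An epimorphism from $(\Xi,\rho,\theta,\Sigma)$ to $(\Xi,\rho',\theta',\Sigma')$ is a continuous surjection $f:\Sigma\to\Sigma'$ with $\rho'(f(\sigma))=\rho(\sigma)$ and $f(\theta_\xi(\sigma))=\theta'_\xi(f(\sigma))$ for all $\sigma\in\Sigma$, $\xi\in\Xi_{\rho(\sigma)}$. The action groupoid $\Xi(\theta')=\Xi\ltimes_{\theta'}\Sigma'$ is the subspace $\{(\xi,\sigma')\in\Xi\times\Sigma':d(\xi)=\rho'(\sigma')\}$ of $\Xi\times\Sigma'$ with multiplication $(\eta,\theta'_\xi(\sigma'))(\xi,\sigma')=(\eta\xi,\sigma')$, inverse $(\xi,\sigma')^{-1}=(\xi^{-1},\theta'_\xi(\sigma'))$, source $(\xi,\sigma')\mapsto\sigma'$ and range $(\xi,\sigma')\mapsto\theta'_\xi(\sigma')$; its unit space $\{(\rho'(\sigma'),\sigma')\}$ is identified with $\Sigma'$. The associated continuous action $(\Xi(\theta'),f,\Theta,\Sigma)$ has anchor $f:\Sigma\to\Sigma'$ and $\Theta_{(\xi,f(\sigma))}(\sigma)=\theta_\xi(\sigma)$ whenever $d(\xi)=\rho(\sigma)$. For any continuous groupoid action: a subset $M\subset\Sigma$ is invariant if $\xi\bullet\tau\in M$ whenever $\tau\in M$ and $d(\xi)=\rho(\tau)$; the orbit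 of $\sigma$ is $\{\xi\bullet\sigma:\xi\in\Xi_{\rho(\sigma)}\}$; transitive means there is just one orbit; pointwise transitive means there is a dense orbit; topologically transitive means each invariant subset is either dense or nowhere dense; the action is minimal if $\Sigma$ is non-empty and has no proper non-void closed invariant subset; $\sigma$ is a fixed point if $\xi\bullet\sigma=\sigma$ for every $\xi\in\Xi_{\rho(\sigma)}$. *)

theory Defs
  imports "HOL-Analysis.Analysis"
begin

section \<open>Topological groupoids\<close>

text \<open>A groupoid is given by its arrows; units are themselves arrows, so that
  source and range take values in the arrows. The arrows are the points of the topology.\<close>

record 'g groupoid =
  arrows_top :: "'g topology"
  src :: "'g \<Rightarrow> 'g"
  rng :: "'g \<Rightarrow> 'g"
  comp :: "'g \<Rightarrow> 'g \<Rightarrow> 'g"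
  ginv :: "'g \<Rightarrow> 'g"

abbreviation arrows :: "('g, 'b) groupoid_scheme \<Rightarrow> 'g set" where
  "arrows G \<equiv> topspace (arrows_top G)"

definition units :: "('g, 'b) groupoid_scheme \<Rightarrow> 'g set" where
  "units G = src G ` arrows G"

abbreviation units_top :: "('g, 'b) groupoid_scheme \<Rightarrow> 'g topology" where
  "units_top G \<equiv> subtopology (arrows_top G) (units G)"

definition src_fibre :: "('g, 'b) groupoid_scheme \<Rightarrow> 'g \<Rightarrow> 'g set" where
  "src_fibre G x = {\<xi> \<in> arrows G. src G \<xi> = x}"

locale groupoid =
  fixes G :: "('g, 'b) groupoid_scheme" (structure)
  assumes src_in: "\<xi> \<in> arrows G \<Longrightarrow> src G \<xi> \<in> arrows G"
    and rng_in: "\<xi> \<in> arrows G \<Longrightarrow> rng G \<xi> \<in> arrows G"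
    and src_src: "\<xi> \<in> arrows G \<Longrightarrow> src G (src G \<xi>) = src G \<xi>"
    and rng_src: "\<xi> \<in> arrows G \<Longrightarrow> rng G (src G \<xi>) = src G \<xi>"
    and src_rng: "\<xi> \<in> arrows G \<Longrightarrow> src G (rng G \<xi>) = rng G \<xi>"
    and rng_rng: "\<xi> \<in> arrows G \<Longrightarrow> rng G (rng G \<xi>) = rng G \<xi>"
    and comp_in: "\<lbrakk>\<xi> \<in> arrows G; \<eta> \<in> arrows G; src G \<xi> = rng G \<eta>\<rbrakk> \<Longrightarrow> comp G \<xi> \<eta> \<in> arrows G"
    and src_comp: "\<lbrakk>\<xi> \<in> arrows G; \<eta> \<in> arrows G; src G \<xi> = rng G \<eta>\<rbrakk>
      \<Longrightarrow> src G (comp G \<xi> \<eta>) = src G \<eta>"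
    and rng_comp: "\<lbrakk>\<xi> \<in> arrows G; \<eta> \<in> arrows G; src G \<xi> = rng G \<eta>\<rbrakk>
      \<Longrightarrow> rng G (comp G \<xi> \<eta>) = rng G \<xi>"
    and comp_assoc: "\<lbrakk>\<xi> \<in> arrows G; \<eta> \<in> arrows G; \<zeta> \<in> arrows G;
        src G \<xi> = rng G \<eta>; src G \<eta> = rng G \<zeta>\<rbrakk>
      \<Longrightarrow> comp G (comp G \<xi> \<eta>) \<zeta> = comp G \<xi> (comp G \<eta> \<zeta>)"
    and comp_src: "\<xi> \<in> arrows G \<Longrightarrow> comp G \<xi> (src G \<xi>) = \<xi>"
    and rng_comp_self: "\<xi> \<in> arrows G \<Longrightarrow> comp G (rng G \<xi>) \<xi> = \<xi>"
    and ginv_in: "\<xi> \<in> arrows G \<Longrightarrow> ginv G \<xi> \<in> arrows G"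
    and src_ginv: "\<xi> \<in> arrows G \<Longrightarrow> src G (ginv G \<xi>) = rng G \<xi>"
    and rng_ginv: "\<xi> \<in> arrows G \<Longrightarrow> rng G (ginv G \<xi>) = src G \<xi>"
    and ginv_comp: "\<xi> \<in> arrows G \<Longrightarrow> comp G (ginv G \<xi>) \<xi> = src G \<xi>"
    and comp_ginv: "\<xi> \<in> arrows G \<Longrightarrow> comp G \<xi> (ginv G \<xi>) = rng G \<xi>"

locale topological_groupoid = groupoid G for G :: "('g, 'b) groupoid_scheme" (structure) +
  assumes Hausdorff_arrows: "Hausdorff_space (arrows_top G)"
    and continuous_ginv: "continuous_map (arrows_top G) (arrows_top G) (ginv G)"
    and continuous_comp:
      "continuous_map
         (subtopology (prod_topology (arrows_top G) (arrows_top G)) {(\<xi>, \<eta>). src G \<xi> = rng G \<eta>})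
         (arrows_top G) (\<lambda>(\<xi>, \<eta>). comp G \<xi> \<eta>)"


section \<open>Continuous groupoid actions\<close>

locale groupoid_action = topological_groupoid G
  for G :: "('g, 'b) groupoid_scheme" (structure) +
  fixes \<rho> :: "'s \<Rightarrow> 'g" and \<theta> :: "'g \<Rightarrow> 's \<Rightarrow> 's" and S :: "'s topology"
  assumes Hausdorff_S: "Hausdorff_space S"
    and continuous_anchor: "continuous_map S (units_top G) \<rho>"
    and anchor_surj: "\<rho> ` topspace S = units G"
    and continuous_act:
      "continuous_map (subtopology (prod_topology (arrows_top G) S) {(\<xi>, \<sigma>). src G \<xi> = \<rho> \<sigma>})
         S (\<lambda>(\<xi>, \<sigma>). \<theta> \<xi> \<sigma>)"
    and act_unit: "\<sigma> \<in> topspace S \<Longrightarrow> \<theta> (\<rho> \<sigma>) \<sigma> = \<sigma>"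
    and anchor_act: "\<lbrakk>\<xi> \<in> arrows G; \<eta> \<in> arrows G; \<sigma> \<in> topspace S;
        src G \<xi> = rng G \<eta>; src G \<eta> = \<rho> \<sigma>\<rbrakk> \<Longrightarrow> src G \<xi> = \<rho> (\<theta> \<eta> \<sigma>)"
    and act_comp: "\<lbrakk>\<xi> \<in> arrows G; \<eta> \<in> arrows G; \<sigma> \<in> topspace S;
        src G \<xi> = rng G \<eta>; src G \<eta> = \<rho> \<sigma>\<rbrakk> \<Longrightarrow> \<theta> (comp G \<xi> \<eta>) \<sigma> = \<theta> \<xi> (\<theta> \<eta> \<sigma>)"

text \<open>All notions below take the same data \<open>(G, \<rho>, \<theta>, S)\<close>, even where some of it is not used.\<close>

definition invariant ::
  "('g, 'b) groupoid_scheme \<Rightarrow> ('s \<Rightarrow> 'g) \<Rightarrow> ('g \<Rightarrow> 's \<Rightarrow> 's) \<Rightarrow> 's topology \<Rightarrow> 's set \<Rightarrow> bool" where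
  "invariant G \<rho> \<theta> S M \<longleftrightarrow>
     M \<subseteq> topspace S \<and> (\<forall>\<tau>\<in>M. \<forall>\<xi>\<in>arrows G. src G \<xi> = \<rho> \<tau> \<longrightarrow> \<theta> \<xi> \<tau> \<in> M)"

definition orbit ::
  "('g, 'b) groupoid_scheme \<Rightarrow> ('s \<Rightarrow> 'g) \<Rightarrow> ('g \<Rightarrow> 's \<Rightarrow> 's) \<Rightarrow> 's topology \<Rightarrow> 's \<Rightarrow> 's set" where
  "orbit G \<rho> \<theta> S \<sigma> = (\<lambda>\<xi>. \<theta> \<xi> \<sigma>) ` src_fibre G (\<rho> \<sigma>)"

definition dense_in :: "'s topology \<Rightarrow> 's set \<Rightarrow> bool" where
  "dense_in S M \<longleftrightarrow> S closure_of M = topspace S"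

definition nowhere_dense_in :: "'s topology \<Rightarrow> 's set \<Rightarrow> bool" where
  "nowhere_dense_in S M \<longleftrightarrow> S interior_of (S closure_of M) = {}"

definition transitive_action ::
  "('g, 'b) groupoid_scheme \<Rightarrow> ('s \<Rightarrow> 'g) \<Rightarrow> ('g \<Rightarrow> 's \<Rightarrow> 's) \<Rightarrow> 's topology \<Rightarrow> bool" where
  "transitive_action G \<rho> \<theta> S \<longleftrightarrow> (\<exists>!Q. Q \<in> orbit G \<rho> \<theta> S ` topspace S)"

definition pointwise_transitive ::
  "('g, 'b) groupoid_scheme \<Rightarrow> ('s \<Rightarrow> 'g) \<Rightarrow> ('g \<Rightarrow> 's \<Rightarrow> 's) \<Rightarrow> 's topology \<Rightarrow> bool" where
  "pointwise_transitive G \<rho> \<theta> S \<longleftrightarrow> (\<exists>\<sigma>\<in>topspace S. dense_in S (orbit G \<rho> \<theta> S \<sigma>))"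

definition topologically_transitive ::
  "('g, 'b) groupoid_scheme \<Rightarrow> ('s \<Rightarrow> 'g) \<Rightarrow> ('g \<Rightarrow> 's \<Rightarrow> 's) \<Rightarrow> 's topology \<Rightarrow> bool" where
  "topologically_transitive G \<rho> \<theta> S \<longleftrightarrow>
     (\<forall>M. invariant G \<rho> \<theta> S M \<longrightarrow> dense_in S M \<or> nowhere_dense_in S M)"

definition not_union_of_proper_closed_invariant ::
  "('g, 'b) groupoid_scheme \<Rightarrow> ('s \<Rightarrow> 'g) \<Rightarrow> ('g \<Rightarrow> 's \<Rightarrow> 's) \<Rightarrow> 's topology \<Rightarrow> bool" where
  "not_union_of_proper_closed_invariant G \<rho> \<theta> S \<longleftrightarrow>
     \<not> (\<exists>C D. invariant G \<rho> \<theta> S C \<and> closedin S C \<and> C \<noteq> topspace S \<and>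
            invariant G \<rho> \<theta> S D \<and> closedin S D \<and> D \<noteq> topspace S \<and>
            topspace S = C \<union> D)"

definition open_invariant_dense ::
  "('g, 'b) groupoid_scheme \<Rightarrow> ('s \<Rightarrow> 'g) \<Rightarrow> ('g \<Rightarrow> 's \<Rightarrow> 's) \<Rightarrow> 's topology \<Rightarrow> bool" where
  "open_invariant_dense G \<rho> \<theta> S \<longleftrightarrow>
     (\<forall>U. invariant G \<rho> \<theta> S U \<and> openin S U \<and> U \<noteq> {} \<longrightarrow> dense_in S U)"

definition minimal_action ::
  "('g, 'b) groupoid_scheme \<Rightarrow> ('s \<Rightarrow> 'g) \<Rightarrow> ('g \<Rightarrow> 's \<Rightarrow> 's) \<Rightarrow> 's topology \<Rightarrow> bool" where
  "minimal_action G \<rho> \<theta> S \<longleftrightarrow>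
     topspace S \<noteq> {} \<and>
     \<not> (\<exists>C. invariant G \<rho> \<theta> S C \<and> closedin S C \<and> C \<noteq> {} \<and> C \<noteq> topspace S)"

definition fixed_points ::
  "('g, 'b) groupoid_scheme \<Rightarrow> ('s \<Rightarrow> 'g) \<Rightarrow> ('g \<Rightarrow> 's \<Rightarrow> 's) \<Rightarrow> 's topology \<Rightarrow> 's set" where
  "fixed_points G \<rho> \<theta> S = {\<sigma> \<in> topspace S. \<forall>\<xi>\<in>src_fibre G (\<rho> \<sigma>). \<theta> \<xi> \<sigma> = \<sigma>}"


section \<open>Epimorphisms and the action groupoid\<close>

definition epimorphism ::
  "('g, 'b) groupoid_scheme \<Rightarrow> ('s \<Rightarrow> 'g) \<Rightarrow> ('g \<Rightarrow> 's \<Rightarrow> 's) \<Rightarrow> 's topology \<Rightarrow>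
   ('t \<Rightarrow> 'g) \<Rightarrow> ('g \<Rightarrow> 't \<Rightarrow> 't) \<Rightarrow> 't topology \<Rightarrow> ('s \<Rightarrow> 't) \<Rightarrow> bool" where
  "epimorphism G \<rho> \<theta> S \<rho>' \<theta>' S' f \<longleftrightarrow>
     continuous_map S S' f \<and> f ` topspace S = topspace S' \<and>
     (\<forall>\<sigma>\<in>topspace S. \<rho>' (f \<sigma>) = \<rho> \<sigma>) \<and>
     (\<forall>\<sigma>\<in>topspace S. \<forall>\<xi>\<in>src_fibre G (\<rho> \<sigma>). f (\<theta> \<xi> \<sigma>) = \<theta>' \<xi> (f \<sigma>))"

text \<open>The identification of \<open>S'\<close> with the unit space of the action groupoid.\<close>

definition unit_at :: "('t \<Rightarrow> 'g) \<Rightarrow> 't \<Rightarrow> 'g \<times> 't" where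
  "unit_at \<rho>' \<sigma>' = (\<rho>' \<sigma>', \<sigma>')"

definition action_groupoid ::
  "('g, 'b) groupoid_scheme \<Rightarrow> ('t \<Rightarrow> 'g) \<Rightarrow> ('g \<Rightarrow> 't \<Rightarrow> 't) \<Rightarrow> 't topology \<Rightarrow> ('g \<times> 't) groupoid" where
  "action_groupoid G \<rho>' \<theta>' S' =
     \<lparr> arrows_top = subtopology (prod_topology (arrows_top G) S') {(\<xi>, \<sigma>'). src G \<xi> = \<rho>' \<sigma>'},
       src = (\<lambda>(\<xi>, \<sigma>'). unit_at \<rho>' \<sigma>'),
       rng = (\<lambda>(\<xi>, \<sigma>'). unit_at \<rho>' (\<theta>' \<xi> \<sigma>')),
       comp = (\<lambda>(\<eta>, \<tau>') (\<xi>, \<sigma>'). (comp G \<eta> \<xi>, \<sigma>')),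
       ginv = (\<lambda>(\<xi>, \<sigma>'). (ginv G \<xi>, \<theta>' \<xi> \<sigma>')) \<rparr>"

text \<open>The anchor \<open>f\<close> of the associated action, with values in the units of the action groupoid.\<close>

definition assoc_anchor :: "('t \<Rightarrow> 'g) \<Rightarrow> ('s \<Rightarrow> 't) \<Rightarrow> 's \<Rightarrow> 'g \<times> 't" where
  "assoc_anchor \<rho>' f \<sigma> = unit_at \<rho>' (f \<sigma>)"

text \<open>An arrow \<open>(\<xi>, \<sigma>')\<close> acts only on points \<open>\<sigma>\<close> with \<open>\<sigma>' = f \<sigma>\<close>; the values elsewhere are irrelevant.\<close>

definition assoc_act :: "('g \<Rightarrow> 's \<Rightarrow> 's) \<Rightarrow> 'g \<times> 't \<Rightarrow> 's \<Rightarrow> 's" where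
  "assoc_act \<theta> = (\<lambda>(\<xi>, \<sigma>') \<sigma>. \<theta> \<xi> \<sigma>)"

section \<open>The associated action is a continuous groupoid action\<close>

context groupoid_action
begin

lemma anchor_in_units: "\<sigma> \<in> topspace S \<Longrightarrow> \<rho> \<sigma> \<in> units G"
  using anchor_surj by blast

lemma units_arrows: "u \<in> units G \<Longrightarrow> u \<in> arrows G \<and> src G u = u \<and> rng G u = u"
  unfolding units_def using src_in src_src rng_src by auto

lemma anchor_unit:
  assumes "\<sigma> \<in> topspace S"
  shows "\<rho> \<sigma> \<in> arrows G" "src G (\<rho> \<sigma>) = \<rho> \<sigma>" "rng G (\<rho> \<sigma>) = \<rho> \<sigma>"
  using units_arrows[OF anchor_in_units[OF assms]] by auto

lemma act_in: "\<lbrakk>\<xi> \<in> arrows G; \<sigma> \<in> topspace S; src G \<xi> = \<rho> \<sigma>\<rbrakk> \<Longrightarrow> \<theta> \<xi> \<sigma> \<in> topspace S"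
  using funcset_mem[OF continuous_map_funspace[OF continuous_act], of "(\<xi>, \<sigma>)"] by simp

lemma anchor_act_rng: "\<lbrakk>\<xi> \<in> arrows G; \<sigma> \<in> topspace S; src G \<xi> = \<rho> \<sigma>\<rbrakk> \<Longrightarrow> \<rho> (\<theta> \<xi> \<sigma>) = rng G \<xi>"
  using anchor_act[of "rng G \<xi>" \<xi> \<sigma>] rng_in src_rng by auto

lemma ginv_act:
  assumes "\<xi> \<in> arrows G" "\<sigma> \<in> topspace S" "src G \<xi> = \<rho> \<sigma>"
  shows "\<theta> (ginv G \<xi>) (\<theta> \<xi> \<sigma>) = \<sigma>"
  using act_comp[of "ginv G \<xi>" \<xi> \<sigma>] assms ginv_in src_ginv ginv_comp act_unit by auto

lemma act_rng: "\<lbrakk>\<xi> \<in> arrows G; \<sigma> \<in> topspace S; src G \<xi> = \<rho> \<sigma>\<rbrakk> \<Longrightarrow> \<theta> (rng G \<xi>) (\<theta> \<xi> \<sigma>) = \<theta> \<xi> \<sigma>"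
  using act_unit[of "\<theta> \<xi> \<sigma>"] act_in anchor_act_rng by auto

lemma comp_anchor: "\<lbrakk>\<xi> \<in> arrows G; src G \<xi> = \<rho> \<sigma>\<rbrakk> \<Longrightarrow> comp G \<xi> (\<rho> \<sigma>) = \<xi>"
  using comp_src[of \<xi>] by simp

lemma groupoid_action_groupoid: "groupoid (action_groupoid G \<rho> \<theta> S)"
  by (rule groupoid.intro)
    (simp_all add: action_groupoid_def unit_at_def split_paired_all src_in rng_in src_src rng_src src_rng
      rng_rng comp_in src_comp rng_comp comp_assoc comp_src rng_comp_self ginv_in src_ginv rng_ginv
      ginv_comp comp_ginv anchor_unit act_in anchor_act_rng ginv_act act_unit act_comp act_rng
      comp_anchor)

lemma topological_groupoid_action_groupoid: "topological_groupoid (action_groupoid G \<rho> \<theta> S)"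
proof -
  let ?A = "action_groupoid G \<rho> \<theta> S"
  let ?D = "subtopology (prod_topology (arrows_top G) S) {(\<xi>, \<sigma>). src G \<xi> = \<rho> \<sigma>}"
  have T: "arrows_top ?A = ?D" by (simp add: action_groupoid_def)
  have f1: "continuous_map ?D (arrows_top G) fst" and s1: "continuous_map ?D S snd"
    by (auto intro: continuous_map_from_subtopology continuous_map_fst continuous_map_snd)
  have inv: "continuous_map ?D ?D (\<lambda>x. (ginv G (fst x), \<theta> (fst x) (snd x)))"
    unfolding continuous_map_in_subtopology
  proof
    show "continuous_map ?D (prod_topology (arrows_top G) S) (\<lambda>x. (ginv G (fst x), \<theta> (fst x) (snd x)))"
      using continuous_map_compose[OF f1 continuous_ginv] continuous_act
      by (simp add: continuous_map_paired o_def case_prod_unfold)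
  qed (auto simp: src_ginv anchor_act_rng)
  let ?P = "subtopology (prod_topology ?D ?D) {(x, y). src ?A x = rng ?A y}"
  have pf: "continuous_map ?P ?D fst" and ps: "continuous_map ?P ?D snd"
    by (auto intro: continuous_map_from_subtopology continuous_map_fst continuous_map_snd)
  have m: "continuous_map ?P (subtopology (prod_topology (arrows_top G) (arrows_top G))
             {(\<xi>, \<eta>). src G \<xi> = rng G \<eta>}) (\<lambda>z. (fst (fst z), fst (snd z)))"
    unfolding continuous_map_in_subtopology
  proof
    show "continuous_map ?P (prod_topology (arrows_top G) (arrows_top G)) (\<lambda>z. (fst (fst z), fst (snd z)))"
      using continuous_map_compose[OF pf f1] continuous_map_compose[OF ps f1]
      by (simp add: continuous_map_paired o_def)
  qed (auto simp: action_groupoid_def unit_at_def anchor_act_rng)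
  have cc: "continuous_map ?P ?D (\<lambda>z. (comp G (fst (fst z)) (fst (snd z)), snd (snd z)))"
    unfolding continuous_map_in_subtopology
  proof
    show "continuous_map ?P (prod_topology (arrows_top G) S)
            (\<lambda>z. (comp G (fst (fst z)) (fst (snd z)), snd (snd z)))"
      using continuous_map_compose[OF m continuous_comp] continuous_map_compose[OF ps s1]
      by (simp add: continuous_map_paired o_def)
  qed (auto simp: action_groupoid_def unit_at_def anchor_act_rng src_comp)
  show ?thesis
  proof (intro topological_groupoid.intro topological_groupoid_axioms.intro groupoid_action_groupoid)
    show "Hausdorff_space (arrows_top ?A)"
      unfolding T using Hausdorff_arrows Hausdorff_S
      by (simp add: Hausdorff_space_prod_topology Hausdorff_space_subtopology)
    show "continuous_map (arrows_top ?A) (arrows_top ?A) (ginv ?A)"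
      using inv unfolding T by (simp add: action_groupoid_def case_prod_unfold)
    have "(\<lambda>(x, y). comp ?A x y) = (\<lambda>z. (comp G (fst (fst z)) (fst (snd z)), snd (snd z)))"
      by (auto simp: action_groupoid_def)
    then show "continuous_map
         (subtopology (prod_topology (arrows_top ?A) (arrows_top ?A)) {(\<xi>, \<eta>). src ?A \<xi> = rng ?A \<eta>})
         (arrows_top ?A) (\<lambda>(\<xi>, \<eta>). comp ?A \<xi> \<eta>)"
      using cc unfolding T by simp
  qed
qed

lemma units_action_groupoid: "units (action_groupoid G \<rho> \<theta> S) = unit_at \<rho> ` topspace S"
proof -
  have "unit_at \<rho> \<sigma> \<in> units (action_groupoid G \<rho> \<theta> S)" if "\<sigma> \<in> topspace S" for \<sigma>
    unfolding units_def
    by (rule image_eqI[where x = "unit_at \<rho> \<sigma>"])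
       (use that anchor_unit in \<open>auto simp: action_groupoid_def unit_at_def\<close>)
  then show ?thesis
    by (auto simp: units_def action_groupoid_def)
qed

lemma continuous_unit_at: "continuous_map S (units_top (action_groupoid G \<rho> \<theta> S)) (unit_at \<rho>)"
proof -
  have "continuous_map S (arrows_top G) \<rho>"
    using continuous_anchor by (simp add: continuous_map_in_subtopology)
  then have "continuous_map S (prod_topology (arrows_top G) S) (unit_at \<rho>)"
    by (simp add: unit_at_def[abs_def] continuous_map_paired)
  then show ?thesis
    unfolding continuous_map_in_subtopology units_action_groupoid
    by (auto simp: action_groupoid_def continuous_map_in_subtopology unit_at_def anchor_unit)
qed

lemma homeomorphic_map_unit_at:
  "homeomorphic_map S (units_top (action_groupoid G \<rho> \<theta> S)) (unit_at \<rho>)"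
proof -
  have "continuous_map (units_top (action_groupoid G \<rho> \<theta> S)) S snd"
    by (auto simp: action_groupoid_def intro: continuous_map_from_subtopology continuous_map_snd)
  then have "homeomorphic_maps S (units_top (action_groupoid G \<rho> \<theta> S)) (unit_at \<rho>) snd"
    using continuous_unit_at
    by (auto simp: homeomorphic_maps_def units_action_groupoid unit_at_def)
  then show ?thesis
    using homeomorphic_maps_map by blast
qed

end

lemma groupoid_action_assoc:
  assumes A: "groupoid_action G \<rho> \<theta> S" and A': "groupoid_action G \<rho>' \<theta>' S'"
    and E: "epimorphism G \<rho> \<theta> S \<rho>' \<theta>' S' f"
  shows "groupoid_action (action_groupoid G \<rho>' \<theta>' S') (assoc_anchor \<rho>' f) (assoc_act \<theta>) S"
proof -
  interpret A: groupoid_action G \<rho> \<theta> S by fact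
  interpret A': groupoid_action G \<rho>' \<theta>' S' by fact
  let ?H = "action_groupoid G \<rho>' \<theta>' S'"
  have f: "continuous_map S S' f" "f ` topspace S = topspace S'"
    and fin: "\<And>\<sigma>. \<sigma> \<in> topspace S \<Longrightarrow> f \<sigma> \<in> topspace S'"
    and f\<rho>: "\<And>\<sigma>. \<sigma> \<in> topspace S \<Longrightarrow> \<rho>' (f \<sigma>) = \<rho> \<sigma>"
    and f\<theta>: "\<And>\<sigma> \<xi>. \<lbrakk>\<sigma> \<in> topspace S; \<xi> \<in> arrows G; src G \<xi> = \<rho> \<sigma>\<rbrakk> \<Longrightarrow> f (\<theta> \<xi> \<sigma>) = \<theta>' \<xi> (f \<sigma>)"
    using E unfolding epimorphism_def src_fibre_def by auto
  let ?Q = "subtopology (prod_topology (arrows_top ?H) S) {(x, \<sigma>). src ?H x = assoc_anchor \<rho>' f \<sigma>}"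
  have "continuous_map ?Q (arrows_top ?H) fst" and qs: "continuous_map ?Q S snd"
    by (auto intro: continuous_map_from_subtopology continuous_map_fst continuous_map_snd)
  moreover have "continuous_map (arrows_top ?H) (arrows_top G) fst"
    by (auto simp: action_groupoid_def intro: continuous_map_from_subtopology continuous_map_fst)
  ultimately have "continuous_map ?Q (arrows_top G) (\<lambda>z. fst (fst z))"
    using continuous_map_compose by (fastforce simp: o_def)
  then have "continuous_map ?Q (prod_topology (arrows_top G) S) (\<lambda>z. (fst (fst z), snd z))"
    using qs by (simp add: continuous_map_paired)
  then have "continuous_map ?Q
      (subtopology (prod_topology (arrows_top G) S) {(\<xi>, \<sigma>). src G \<xi> = \<rho> \<sigma>}) (\<lambda>z. (fst (fst z), snd z))"
    unfolding continuous_map_in_subtopology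
    by (auto simp: action_groupoid_def assoc_anchor_def unit_at_def f\<rho>)
  from continuous_map_compose[OF this A.continuous_act]
  have cont: "continuous_map ?Q S (\<lambda>(x, \<sigma>). assoc_act \<theta> x \<sigma>)"
    by (simp add: o_def case_prod_unfold assoc_act_def)
  show ?thesis
  proof (intro groupoid_action.intro groupoid_action_axioms.intro
      A'.topological_groupoid_action_groupoid A.Hausdorff_S cont)
    show "continuous_map S (units_top ?H) (assoc_anchor \<rho>' f)"
      using continuous_map_compose[OF f(1) A'.continuous_unit_at]
      by (simp add: o_def assoc_anchor_def[abs_def])
    show "assoc_anchor \<rho>' f ` topspace S = units ?H"
      unfolding A'.units_action_groupoid f(2)[symmetric] image_image assoc_anchor_def ..
  qed (auto simp: action_groupoid_def assoc_anchor_def unit_at_def assoc_act_def f\<rho> f\<theta> fin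
      A.act_unit A.act_comp A'.anchor_act_rng A.anchor_act_rng)
qed

end

theory Submission
  imports Defs
begin

text \<open>Each of the properties in question depends on the action only through its orbits: a subset of
  \<open>\<Sigma>\<close> is invariant iff it contains the orbit of each of its points, a point is fixed iff its orbit is
  contained in the singleton of that point, and all the other properties are formulated with orbits,
  with invariant sets, and with the topology of \<open>\<Sigma>\<close>.

  The two actions have the same orbits. The arrows of \<open>\<Xi>(\<theta>')\<close> that can be applied to \<open>\<sigma>\<close> are those
  with source \<open>f \<sigma>\<close>, that is, the pairs \<open>(\<xi>, f \<sigma>)\<close> with \<open>d \<xi> = \<rho>' (f \<sigma>)\<close>. As \<open>\<rho>' (f \<sigma>) = \<rho> \<sigma>\<close>, they
  correspond to the arrows \<open>\<xi>\<close> of \<open>\<Xi>\<close> that can be applied to \<open>\<sigma>\<close>, and \<open>(\<xi>, f \<sigma>)\<close> moves \<open>\<sigma>\<close> to the same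
  point as \<open>\<xi>\<close>. This is \<open>orbit_assoc_action\<close>; \<open>invariant_iff_orbits\<close> and \<open>fixed_points_eq_orbits\<close> make
  the reduction to orbits.\<close>

lemma invariant_iff_orbits:
  "invariant G \<rho> \<theta> S M \<longleftrightarrow> M \<subseteq> topspace S \<and> (\<forall>\<tau>\<in>M. orbit G \<rho> \<theta> S \<tau> \<subseteq> M)"
  by (auto simp: invariant_def orbit_def src_fibre_def)

lemma fixed_points_eq_orbits:
  "fixed_points G \<rho> \<theta> S = {\<sigma> \<in> topspace S. orbit G \<rho> \<theta> S \<sigma> \<subseteq> {\<sigma>}}"
  by (auto simp: fixed_points_def orbit_def)

lemma same_orbits_imp_same_invariant:
  assumes "\<And>\<sigma>. \<sigma> \<in> topspace S \<Longrightarrow> orbit G \<rho> \<theta> S \<sigma> = orbit H \<kappa> \<phi> S \<sigma>"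
  shows "invariant G \<rho> \<theta> S = invariant H \<kappa> \<phi> S"
proof
  fix M
  have "(\<forall>\<tau>\<in>M. orbit G \<rho> \<theta> S \<tau> \<subseteq> M) \<longleftrightarrow> (\<forall>\<tau>\<in>M. orbit H \<kappa> \<phi> S \<tau> \<subseteq> M)" if "M \<subseteq> topspace S"
    by (rule ball_cong) (use that assms in auto)
  then show "invariant G \<rho> \<theta> S M = invariant H \<kappa> \<phi> S M"
    by (auto simp only: invariant_iff_orbits)
qed

text \<open>An arrow of the action groupoid carries its source as its second component, so fixing the
  source leaves exactly the freedom to choose an arrow of \<open>G\<close> that can be applied to that point.\<close>

lemma src_fibre_action_groupoid:
  assumes "\<sigma>' \<in> topspace S'"
  shows "src_fibre (action_groupoid G \<rho>' \<theta>' S') (unit_at \<rho>' \<sigma>') = src_fibre G (\<rho>' \<sigma>') \<times> {\<sigma>'}"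
  using assms by (auto simp: src_fibre_def action_groupoid_def unit_at_def)

text \<open>Since \<open>f\<close> preserves anchors, the source fibre of the action groupoid over \<open>f \<sigma>\<close> is a copy
  of the source fibre of \<open>G\<close> over \<open>\<rho> \<sigma>\<close>, and the second component of an arrow does not affect how it acts.\<close>

lemma orbit_assoc_action:
  assumes "epimorphism G \<rho> \<theta> S \<rho>' \<theta>' S' f" and "\<sigma> \<in> topspace S"
  shows "orbit (action_groupoid G \<rho>' \<theta>' S') (assoc_anchor \<rho>' f) (assoc_act \<theta>) S \<sigma> = orbit G \<rho> \<theta> S \<sigma>"
proof -
  have "f \<sigma> \<in> topspace S'" and "\<rho>' (f \<sigma>) = \<rho> \<sigma>"
    using assms by (auto simp: epimorphism_def)
  then show ?thesis
    by (force simp: orbit_def assoc_anchor_def assoc_act_def src_fibre_action_groupoid)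
qed

theorem proposition7p13:
  fixes \<Xi> :: "'g groupoid"
    and \<rho> :: "'s \<Rightarrow> 'g" and \<theta> :: "'g \<Rightarrow> 's \<Rightarrow> 's" and \<Sigma> :: "'s topology"
    and \<rho>' :: "'t \<Rightarrow> 'g" and \<theta>' :: "'g \<Rightarrow> 't \<Rightarrow> 't" and \<Sigma>' :: "'t topology"
    and f :: "'s \<Rightarrow> 't"
  assumes "groupoid_action \<Xi> \<rho> \<theta> \<Sigma>"
    and "groupoid_action \<Xi> \<rho>' \<theta>' \<Sigma>'"
    and "epimorphism \<Xi> \<rho> \<theta> \<Sigma> \<rho>' \<theta>' \<Sigma>' f"
  shows "(\<forall>M. invariant \<Xi> \<rho> \<theta> \<Sigma> M \<longleftrightarrow>
           invariant (action_groupoid \<Xi> \<rho>' \<theta>' \<Sigma>') (assoc_anchor \<rho>' f) (assoc_act \<theta>) \<Sigma> M)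
    \<and> (transitive_action \<Xi> \<rho> \<theta> \<Sigma> \<longleftrightarrow>
           transitive_action (action_groupoid \<Xi> \<rho>' \<theta>' \<Sigma>') (assoc_anchor \<rho>' f) (assoc_act \<theta>) \<Sigma>)
    \<and> (pointwise_transitive \<Xi> \<rho> \<theta> \<Sigma> \<longleftrightarrow>
           pointwise_transitive (action_groupoid \<Xi> \<rho>' \<theta>' \<Sigma>') (assoc_anchor \<rho>' f) (assoc_act \<theta>) \<Sigma>)
    \<and> (topologically_transitive \<Xi> \<rho> \<theta> \<Sigma> \<longleftrightarrow>
           topologically_transitive (action_groupoid \<Xi> \<rho>' \<theta>' \<Sigma>') (assoc_anchor \<rho>' f) (assoc_act \<theta>) \<Sigma>)
    \<and> (not_union_of_proper_closed_invariant \<Xi> \<rho> \<theta> \<Sigma> \<longleftrightarrow>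
           not_union_of_proper_closed_invariant (action_groupoid \<Xi> \<rho>' \<theta>' \<Sigma>') (assoc_anchor \<rho>' f) (assoc_act \<theta>) \<Sigma>)
    \<and> (open_invariant_dense \<Xi> \<rho> \<theta> \<Sigma> \<longleftrightarrow>
           open_invariant_dense (action_groupoid \<Xi> \<rho>' \<theta>' \<Sigma>') (assoc_anchor \<rho>' f) (assoc_act \<theta>) \<Sigma>)
    \<and> (minimal_action \<Xi> \<rho> \<theta> \<Sigma> \<longleftrightarrow>
           minimal_action (action_groupoid \<Xi> \<rho>' \<theta>' \<Sigma>') (assoc_anchor \<rho>' f) (assoc_act \<theta>) \<Sigma>)
    \<and> fixed_points \<Xi> \<rho> \<theta> \<Sigma> =
           fixed_points (action_groupoid \<Xi> \<rho>' \<theta>' \<Sigma>') (assoc_anchor \<rho>' f) (assoc_act \<theta>) \<Sigma>"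
proof -
  let ?H = "action_groupoid \<Xi> \<rho>' \<theta>' \<Sigma>'" and ?\<kappa> = "assoc_anchor \<rho>' f" and ?\<phi> = "assoc_act \<theta>"
  have orb: "orbit \<Xi> \<rho> \<theta> \<Sigma> \<sigma> = orbit ?H ?\<kappa> ?\<phi> \<Sigma> \<sigma>" if "\<sigma> \<in> topspace \<Sigma>" for \<sigma>
    using orbit_assoc_action[OF assms(3) that] by simp
  then have inv: "invariant \<Xi> \<rho> \<theta> \<Sigma> = invariant ?H ?\<kappa> ?\<phi> \<Sigma>"
    by (rule same_orbits_imp_same_invariant)
  have orbits: "orbit \<Xi> \<rho> \<theta> \<Sigma> ` topspace \<Sigma> = orbit ?H ?\<kappa> ?\<phi> \<Sigma> ` topspace \<Sigma>"
    by (rule image_cong) (simp_all add: orb)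
  have "transitive_action \<Xi> \<rho> \<theta> \<Sigma> \<longleftrightarrow> transitive_action ?H ?\<kappa> ?\<phi> \<Sigma>"
    by (simp only: transitive_action_def orbits)
  moreover have "pointwise_transitive \<Xi> \<rho> \<theta> \<Sigma> \<longleftrightarrow> pointwise_transitive ?H ?\<kappa> ?\<phi> \<Sigma>"
    by (simp add: pointwise_transitive_def orb)
  moreover have "fixed_points \<Xi> \<rho> \<theta> \<Sigma> = fixed_points ?H ?\<kappa> ?\<phi> \<Sigma>"
    by (auto simp: fixed_points_eq_orbits orb)
  ultimately show ?thesis
    by (simp add: inv topologically_transitive_def not_union_of_proper_closed_invariant_def
        open_invariant_dense_def minimal_action_def)
qed

end
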